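(* Let $S$ be a finite set of non-zero integers and let $d$ be a positive integer. Then for $i=0,1,2$, $$|\mathbf{D}_i(S)|=\frac{2^{|S|}\varphi(d)}{|\mathcal{D}_i|}.$$
   Context: For a non-zero integer $n$, $\mathrm{sqf}(n)$ is its squarefree part: the unique squarefree integer $s$ (of the same sign as $n$) with $n=sm^2$ for some integer $m$. For a finite set $T$ of non-zero integers, $\mathrm{sqf}(T)=\mathrm{sqf}\left(\prod_{s\in T}s\right)$, and $\mathrm{sqf}(\emptyset)=1$. Define sets of subsets of $S$: $\mathcal{D}_0=\{T\subseteq S:\mathrm{sqf}(T)\mid d\}$, $\mathcal{D}_1=\{T\in\mathcal{D}_0:\mathrm{sqf}(T)\equiv 1\text{ or }3\ (\mathrm{mod}\ 4)\}$, $\mathcal{D}_2=\{T\in\mathcal{D}_0:\mathrm{sqf}(T)\equiv 1\ (\mathrm{mod}\ 4)\}$. $\mathbf{F}(S)$ is the group, under pointwise multiplication, of all maps $\theta:S\to\{-1,1\}$; for $T\subseteq S$, $\theta(T)=\prod_{s\in T}\theta(s)$, with $\theta(\emptyset)=1$. $\mathbb{Z}_d^*$ is the group of units modulo $d$, its elements represented by integers $1\le f\le d$ with $(f,d)=1$; it has order $\varphi(d)$. For a positive integer $f$, $\left(\frac{\cdot}{f}\right)$ is the Jacobi symbol (Kronecker symbol if $f$ is even). For $i=0,1,2$, $$\mathbf{D}_i(S)=\left\{(f,\theta)\in\mathbb{Z}_d^*\times\mathbf{F}(S):\theta(T)\left(\frac{\mathrm{sqf}(T)}{f}\right)=1\ \text{for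 all } T\in\mathcal{D}_i\right\},$$ where $f$ in the symbol denotes the chosen representative. *)

theory Defs
  imports Complex_Main "HOL-Number_Theory.Number_Theory"
    "HOL-Computational_Algebra.Squarefree" "HOL-Library.FuncSet"
begin

definition sqf :: "int set \<Rightarrow> int" where
  "sqf T = squarefree_part (\<Prod>s\<in>T. s)"

text \<open>On the integers, \<^const>\<open>squarefree_part\<close> keeps the sign of its argument.\<close>

lemma squarefree_part_int_iff:
  fixes n s :: int
  assumes "n \<noteq> 0"
  shows "squarefree_part n = s \<longleftrightarrow> squarefree s \<and> sgn s = sgn n \<and> (\<exists>m. n = s * m\<^sup>2)"
proof
  assume s: "squarefree_part n = s"
  have n: "n = s * (square_part n)\<^sup>2"
    using squarefree_decompose[of n] s by simp
  have "sgn ((square_part n)\<^sup>2) = 1" using assms by (intro sgn_pos) simp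
  then have "sgn n = sgn s" using n sgn_mult[of s "(square_part n)\<^sup>2"] by (metis mult_1_right)
  with n s show "squarefree s \<and> sgn s = sgn n \<and> (\<exists>m. n = s * m\<^sup>2)" by auto
next
  assume *: "squarefree s \<and> sgn s = sgn n \<and> (\<exists>m. n = s * m\<^sup>2)"
  then obtain m where m: "n = s * m\<^sup>2" by blast
  with assms have nz: "s \<noteq> 0" "m \<noteq> 0" by auto
  have "multiplicity p (squarefree_part n) = multiplicity p s" if p: "prime p" for p
  proof -
    have "multiplicity p n = multiplicity p s + 2 * multiplicity p m"
      unfolding m using p nz
      by (subst prime_elem_multiplicity_mult_distrib)
        (auto simp: prime_elem_multiplicity_power_distrib)
    moreover have "multiplicity p s \<le> 1"
      using * p nz by (auto simp: squarefree_factorial_semiring'')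
    ultimately show ?thesis
      using p by (simp add: prime_multiplicity_squarefree_part)
  qed
  then have abs_eq: "\<bar>squarefree_part n\<bar> = \<bar>s\<bar>"
    using multiplicity_eq_imp_eq[of "squarefree_part n" s] nz by simp
  have n: "n = squarefree_part n * (square_part n)\<^sup>2" by (rule squarefree_decompose)
  have "sgn ((square_part n)\<^sup>2) = 1" using assms by (intro sgn_pos) simp
  then have "sgn n = sgn (squarefree_part n)"
    using n sgn_mult[of "squarefree_part n" "(square_part n)\<^sup>2"] by (metis mult_1_right)
  with * abs_eq show "squarefree_part n = s" by (metis sgn_mult_abs)
qed

text \<open>The Kronecker symbol with positive lower entry \<open>f\<close>: the Legendre symbols of the odd prime
  factors of \<open>f\<close> and the symbol at 2 are multiplied according to multiplicity. For odd \<open>f\<close> this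
  is the Jacobi symbol. (The value for \<open>f = 0\<close> is not meaningful.)\<close>

definition kronecker_prime :: "int \<Rightarrow> nat \<Rightarrow> int" where
  "kronecker_prime a p =
    (if p = 2 then (if even a then 0 else if a mod 8 \<in> {1, 7} then 1 else -1)
     else Legendre a (int p))"

definition kronecker :: "int \<Rightarrow> nat \<Rightarrow> int" where
  "kronecker a f = (\<Prod>p\<in>#prime_factorization f. kronecker_prime a p)"

definition D0_sets :: "nat \<Rightarrow> int set \<Rightarrow> int set set" where
  "D0_sets d S = {T. T \<subseteq> S \<and> sqf T dvd int d}"

definition D1_sets :: "nat \<Rightarrow> int set \<Rightarrow> int set set" where
  "D1_sets d S = {T \<in> D0_sets d S. [sqf T = 1] (mod 4) \<or> [sqf T = 3] (mod 4)}"

definition D2_sets :: "nat \<Rightarrow> int set \<Rightarrow> int set set" where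
  "D2_sets d S = {T \<in> D0_sets d S. [sqf T = 1] (mod 4)}"

definition D_sets :: "nat \<Rightarrow> nat \<Rightarrow> int set \<Rightarrow> int set set" where
  "D_sets i d S = (if i = 0 then D0_sets d S else if i = 1 then D1_sets d S else D2_sets d S)"

text \<open>The maps \<open>S \<rightarrow> {-1, 1}\<close>, taken extensional so that each is represented exactly once.\<close>

definition sign_maps :: "int set \<Rightarrow> (int \<Rightarrow> int) set" where
  "sign_maps S = S \<rightarrow>\<^sub>E {-1, 1}"

text \<open>The units modulo \<open>d\<close> are given by their representatives \<open>1 \<le> f \<le> d\<close>, i.e. by
  \<^term>\<open>totatives d\<close>; the symbol may depend on the representative.\<close>

definition D_group :: "nat \<Rightarrow> nat \<Rightarrow> int set \<Rightarrow> (nat \<times> (int \<Rightarrow> int)) set" where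
  "D_group i d S = {(f, \<theta>). f \<in> totatives d \<and> \<theta> \<in> sign_maps S \<and>
     (\<forall>T \<in> D_sets i d S. (\<Prod>s\<in>T. \<theta> s) * kronecker (sqf T) f = 1)}"

end

(* For a fixed f, the sets in D_i(S) form a subgroup D of the power set of S under symmetric
   difference, and T \<mapsto> (sqf(T)/f) is a character of D because the symbol is multiplicative in its
   upper entry and f is prime to d. Orthogonality of characters then gives 2^|S| / |D| admissible
   sign maps for each of the \<phi>(d) choices of f; no reciprocity law is needed. *)

theory Submission
  imports Defs
begin

section \<open>Characters on subgroups of the power set\<close>

text \<open>Each element of \<open>A \<inter> B\<close> contributes to both factors on the left,
  hence the square. It equals 1 for sign maps and is absorbed by the squarefree part for
  integers.\<close>

lemma prod_sym_diff:
  fixes g :: "'a \<Rightarrow> 'b::comm_monoid_mult"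
  assumes "finite A" "finite B"
  shows "prod g A * prod g B = prod g (sym_diff A B) * (prod g (A \<inter> B))\<^sup>2"
proof -
  have "prod g A = prod g (A - B) * prod g (A \<inter> B)"
    using prod.Int_Diff[OF assms(1), of g B] by (simp add: mult.commute)
  moreover have "prod g B = prod g (B - A) * prod g (A \<inter> B)"
    using prod.Int_Diff[OF assms(2), of g A] by (simp add: mult.commute Int_commute)
  moreover have "prod g (sym_diff A B) = prod g (A - B) * prod g (B - A)"
    using assms by (intro prod.union_disjoint) auto
  ultimately show ?thesis
    by (simp add: power2_eq_square ac_simps)
qed

lemma prod_sign_map:
  assumes "\<theta> \<in> sign_maps S" "T \<subseteq> S"
  shows "(\<Prod>s\<in>T. \<theta> s) \<in> {-1, 1}"
proof -
  have "\<bar>\<theta> s\<bar> = 1" if "s \<in> T" for s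
  proof -
    have "\<theta> s \<in> {-1, 1}"
      using assms that unfolding sign_maps_def by (blast intro: PiE_mem)
    then show ?thesis by auto
  qed
  then have "\<bar>\<Prod>s\<in>T. \<theta> s\<bar> = 1"
    by (simp add: abs_prod)
  then show ?thesis by auto
qed

text \<open>The sum factors over \<open>S\<close>: an element of \<open>T\<close> contributes -1 + 1
  = 0, any other element 1 + 1 = 2.\<close>

lemma sum_sign_maps:
  assumes "finite S" "T \<subseteq> S"
  shows "(\<Sum>\<theta>\<in>sign_maps S. \<Prod>s\<in>T. \<theta> s) = (if T = {} then 2 ^ card S else 0)"
proof -
  have "(\<Sum>\<theta>\<in>sign_maps S. \<Prod>s\<in>T. \<theta> s)
      = (\<Sum>\<theta>\<in>sign_maps S. \<Prod>s\<in>S. if s \<in> T then \<theta> s else 1)"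
    using assms by (simp add: prod.inter_restrict[symmetric] Int_absorb1)
  also have "\<dots> = (\<Prod>s\<in>S. \<Sum>e\<in>{-1, 1}. if s \<in> T then e else 1)"
    unfolding sign_maps_def using assms by (subst prod_sum_PiE) auto
  also have "\<dots> = (\<Prod>s\<in>S. if s \<in> T then 0 else 2)"
    by (intro prod.cong) auto
  also have "\<dots> = (if T = {} then 2 ^ card S else 0)"
    using assms by auto
  finally show ?thesis .
qed

text \<open>If \<open>\<psi> B = -1\<close> for some \<open>B\<close> in \<open>D\<close>, then
  translation by \<open>B\<close> permutes \<open>D\<close> and negates the sum, which is therefore
  0.\<close>

lemma sum_character:
  fixes \<psi> :: "'a set \<Rightarrow> int"
  assumes closed: "\<And>A B. A \<in> D \<Longrightarrow> B \<in> D \<Longrightarrow> sym_diff A B \<in> D"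
    and hom: "\<And>A B. A \<in> D \<Longrightarrow> B \<in> D \<Longrightarrow> \<psi> (sym_diff A B) = \<psi> A * \<psi> B"
    and sign: "\<And>A. A \<in> D \<Longrightarrow> \<psi> A \<in> {-1, 1}"
  shows "(\<Sum>A\<in>D. \<psi> A) = (if \<forall>A\<in>D. \<psi> A = 1 then int (card D) else 0)"
proof (cases "\<forall>A\<in>D. \<psi> A = 1")
  case False
  then obtain B where B: "B \<in> D" "\<psi> B = -1"
    using sign by blast
  have inv: "sym_diff B (sym_diff B A) = A" for A by blast
  have "bij_betw (sym_diff B) D D"
    by (rule bij_betw_byWitness[where f' = "sym_diff B"]) (use inv B closed in auto)
  then have "(\<Sum>A\<in>D. \<psi> A) = (\<Sum>A\<in>D. \<psi> (sym_diff B A))"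
    by (rule sum.reindex_bij_betw[symmetric])
  also have "\<dots> = (\<Sum>A\<in>D. - \<psi> A)"
    by (rule sum.cong) (simp_all add: hom B)
  finally have "(\<Sum>A\<in>D. \<psi> A) = 0"
    by (simp add: sum_negf)
  with False show ?thesis by auto
qed simp

text \<open>Evaluate the double sum of \<open>\<theta>(T) \<chi>(T)\<close> in two ways. Summing
  over \<open>T\<close> first gives \<open>card D\<close> for each admissible
  \<open>\<theta>\<close> and 0 for the others; summing over \<open>\<theta>\<close> first leaves
  only \<open>T = {}\<close>.\<close>

lemma card_sign_maps_extending_character:
  fixes \<chi> :: "int set \<Rightarrow> int"
  assumes S: "finite S" and D: "D \<subseteq> Pow S" "{} \<in> D"
    and closed: "\<And>A B. A \<in> D \<Longrightarrow> B \<in> D \<Longrightarrow> sym_diff A B \<in> D"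
    and hom: "\<And>A B. A \<in> D \<Longrightarrow> B \<in> D \<Longrightarrow> \<chi> (sym_diff A B) = \<chi> A * \<chi> B"
    and sign: "\<And>A. A \<in> D \<Longrightarrow> \<chi> A \<in> {-1, 1}"
  shows "card {\<theta> \<in> sign_maps S. \<forall>T\<in>D. (\<Prod>s\<in>T. \<theta> s) * \<chi> T = 1} * card D = 2 ^ card S"
proof -
  have fin: "finite (sign_maps S)" "finite D"
    unfolding sign_maps_def using S D(1) by (auto intro: finite_PiE finite_subset)
  have orth: "(\<Sum>T\<in>D. (\<Prod>s\<in>T. \<theta> s) * \<chi> T)
      = (if \<forall>T\<in>D. (\<Prod>s\<in>T. \<theta> s) * \<chi> T = 1 then int (card D) else 0)"
    if \<theta>: "\<theta> \<in> sign_maps S" for \<theta>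
  proof (rule sum_character)
    fix A B assume AB: "A \<in> D" "B \<in> D"
    show "sym_diff A B \<in> D" by (rule closed[OF AB])
    have "(\<Prod>s\<in>A \<inter> B. \<theta> s) \<in> {-1, 1}"
      by (rule prod_sign_map[OF \<theta>]) (use AB D in auto)
    then have "(\<Prod>s\<in>A \<inter> B. \<theta> s)\<^sup>2 = 1" by auto
    moreover have "finite A" "finite B"
      using AB D S by (auto intro: finite_subset)
    ultimately have "(\<Prod>s\<in>sym_diff A B. \<theta> s) = (\<Prod>s\<in>A. \<theta> s) * (\<Prod>s\<in>B. \<theta> s)"
      by (simp add: prod_sym_diff)
    then show "(\<Prod>s\<in>sym_diff A B. \<theta> s) * \<chi> (sym_diff A B)
        = ((\<Prod>s\<in>A. \<theta> s) * \<chi> A) * ((\<Prod>s\<in>B. \<theta> s) * \<chi> B)"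
      by (simp add: hom[OF AB])
  next
    fix A assume A: "A \<in> D"
    have "(\<Prod>s\<in>A. \<theta> s) \<in> {-1, 1}"
      by (rule prod_sign_map[OF \<theta>]) (use A D in auto)
    with sign[OF A] show "(\<Prod>s\<in>A. \<theta> s) * \<chi> A \<in> {-1, 1}" by auto
  qed
  have "int (card {\<theta> \<in> sign_maps S. \<forall>T\<in>D. (\<Prod>s\<in>T. \<theta> s) * \<chi> T = 1} * card D)
      = (\<Sum>\<theta>\<in>sign_maps S. if \<forall>T\<in>D. (\<Prod>s\<in>T. \<theta> s) * \<chi> T = 1 then int (card D) else 0)"
    using fin by (simp add: sum.inter_filter[symmetric])
  also have "\<dots> = (\<Sum>\<theta>\<in>sign_maps S. \<Sum>T\<in>D. (\<Prod>s\<in>T. \<theta> s) * \<chi> T)"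
    by (simp add: orth)
  also have "\<dots> = (\<Sum>T\<in>D. (\<Sum>\<theta>\<in>sign_maps S. \<Prod>s\<in>T. \<theta> s) * \<chi> T)"
    by (subst sum.swap) (simp add: sum_distrib_right)
  also have "\<dots> = (\<Sum>T\<in>D. if T = {} then 2 ^ card S * \<chi> T else 0)"
  proof (rule sum.cong)
    fix T assume "T \<in> D"
    then have "T \<subseteq> S" using D(1) by auto
    then show "(\<Sum>\<theta>\<in>sign_maps S. \<Prod>s\<in>T. \<theta> s) * \<chi> T = (if T = {} then 2 ^ card S * \<chi> T else 0)"
      by (simp add: sum_sign_maps[OF S])
  qed simp
  also have "\<dots> = 2 ^ card S * \<chi> {}"
    using fin D by simp
  \<comment> \<open>The empty set is its own symmetric difference with itself, so
    \<open>\<chi> {}\<close> is an idempotent sign.\<close>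
  also have "\<chi> {} = 1"
    using hom[OF D(2) D(2)] sign[OF D(2)] by auto
  finally show ?thesis
    by (simp only: of_nat_eq_iff[where 'a = int, symmetric] of_nat_power of_nat_numeral mult_1_right)
qed

section \<open>Multiplicativity of the Kronecker symbol\<close>

text \<open>The difference is at most 2 in absolute value. This turns the congruences of Euler's
  criterion into equalities.\<close>

lemma cong_signs_imp_eq:
  fixes x y m :: int
  assumes "[x = y] (mod m)" "x \<in> {-1, 0, 1}" "y \<in> {-1, 0, 1}" "m > 2"
  shows "x = y"
proof -
  have "m dvd x - y" using assms(1) by (simp add: cong_iff_dvd_diff)
  \<comment> \<open>\<open>zdvd_imp_le\<close> bounds positive multiples of \<open>m\<close> only,
    so the difference is taken in both orders.\<close>
  then show ?thesis
    using assms(2-) zdvd_imp_le[of m "x - y"] zdvd_imp_le[of m "y - x"]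
    by (auto simp: dvd_diff_commute)
qed

lemma Legendre_mult:
  assumes "prime p" "2 < p"
  shows "Legendre (a * b) (int p) = Legendre a (int p) * Legendre b (int p)"
proof (rule cong_signs_imp_eq)
  have "[Legendre (a * b) (int p) = a ^ ((p - 1) div 2) * b ^ ((p - 1) div 2)] (mod int p)"
    using euler_criterion[OF assms, of "a * b"] by (simp add: power_mult_distrib)
  then show "[Legendre (a * b) (int p) = Legendre a (int p) * Legendre b (int p)] (mod int p)"
    using cong_mult[OF euler_criterion[OF assms, of a] euler_criterion[OF assms, of b]]
    by (meson cong_sym cong_trans)
qed (use assms in \<open>auto simp: Legendre_def\<close>)

text \<open>On odd entries the symbol at 2 is the character of the units modulo 8 with kernel {1,
  7}, so the residues can be checked in turn; if an entry is even, both sides are 0.\<close>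

lemma kronecker_prime_2_mult:
  "kronecker_prime (a * b) 2 = kronecker_prime a 2 * kronecker_prime b 2"
proof (cases "even a \<or> even b")
  case False
  then have "a mod 8 \<in> {1, 3, 5, 7}" "b mod 8 \<in> {1, 3, 5, 7}"
    by (auto simp del: One_nat_def; presburger)+
  moreover have "(a * b) mod 8 = ((a mod 8) * (b mod 8)) mod 8"
    by (simp add: mod_mult_eq)
  ultimately show ?thesis
    using False by (auto simp: kronecker_prime_def)
qed (auto simp: kronecker_prime_def)

lemma kronecker_prime_mult:
  assumes "prime p"
  shows "kronecker_prime (a * b) p = kronecker_prime a p * kronecker_prime b p"
proof (cases "p = 2")
  case True
  then show ?thesis by (simp add: kronecker_prime_2_mult)
next
  case False
  then have "2 < p" using prime_ge_2_nat[OF assms] by simp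
  with False show ?thesis
    by (simp add: kronecker_prime_def Legendre_mult assms)
qed

lemma kronecker_mult: "kronecker (a * b) f = kronecker a f * kronecker b f"
proof -
  have "kronecker (a * b) f
      = (\<Prod>p\<in>#prime_factorization f. kronecker_prime a p * kronecker_prime b p)"
    unfolding kronecker_def
    by (intro arg_cong[where f = prod_mset] image_mset_cong)
      (auto intro!: kronecker_prime_mult dest: in_prime_factors_imp_prime)
  then show ?thesis by (simp add: kronecker_def prod_mset.distrib)
qed

lemma prod_mset_signs:
  fixes M :: "int multiset"
  assumes "\<forall>x\<in>#M. x \<in> {-1, 1}"
  shows "\<Prod>\<^sub># M \<in> {-1, 1}"
  using assms by (induction M) auto

text \<open>The symbol at a prime \<open>p\<close> vanishes only if \<open>p\<close> divides
  \<open>a\<close>, which coprimality excludes for every prime factor of \<open>f\<close>.\<close>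

lemma kronecker_sign:
  assumes "coprime a (int f)" "f > 0"
  shows "kronecker a f \<in> {-1, 1}"
proof -
  have "kronecker_prime a p \<in> {-1, 1}" if "p \<in># prime_factorization f" for p
  proof -
    have "prime p" "p dvd f" using that by (auto simp: prime_factors_dvd)
    have "\<not> int p dvd a"
    proof
      assume "int p dvd a"
      then have "is_unit (int p)"
        using assms(1) \<open>p dvd f\<close> by (meson coprime_common_divisor int_dvd_int_iff)
      with \<open>prime p\<close> show False by simp
    qed
    then show ?thesis
      by (auto simp: kronecker_prime_def Legendre_def cong_0_iff)
  qed
  then have "\<forall>x\<in>#image_mset (kronecker_prime a) (prime_factorization f). x \<in> {-1, 1}"
    by simp
  then have "(\<Prod>p\<in>#prime_factorization f. kronecker_prime a p) \<in> {-1, 1}"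
    by (rule prod_mset_signs)
  then show ?thesis by (simp add: kronecker_def)
qed

section \<open>Squarefree parts of products over sets\<close>

lemma squarefree_part_mult_square:
  fixes n k :: int
  assumes "n \<noteq> 0" "k \<noteq> 0"
  shows "squarefree_part (n * k\<^sup>2) = squarefree_part n"
proof -
  have "n * k\<^sup>2 = squarefree_part n * (square_part n * k)\<^sup>2"
    using squarefree_decompose[of n] by (metis mult.assoc power_mult_distrib)
  moreover have "sgn (squarefree_part n) = sgn n"
    using squarefree_part_int_iff[OF assms(1)] by blast
  moreover have "sgn (k\<^sup>2) = 1"
    using assms(2) by (intro sgn_pos) simp
  then have "sgn (n * k\<^sup>2) = sgn n"
    unfolding sgn_mult by simp
  ultimately show ?thesis
    using assms by (subst squarefree_part_int_iff) auto
qed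

text \<open>The common part of \<open>a\<close> and \<open>b\<close> occurs twice in the product and
  joins the square; the two cofactors are squarefree and coprime, so their product is
  squarefree.\<close>

lemma squarefree_part_mult:
  fixes m n :: int
  assumes "m \<noteq> 0" "n \<noteq> 0"
  defines "a \<equiv> squarefree_part m" and "b \<equiv> squarefree_part n"
  shows "squarefree_part (m * n) = (a div gcd a b) * (b div gcd a b)"
proof -
  define g where "g = gcd a b"
  have nz: "a \<noteq> 0" "b \<noteq> 0" "g \<noteq> 0" by (simp_all add: a_def b_def g_def)
  have ab: "a = a div g * g" "b = b div g * g" by (simp_all add: g_def)
  have sqf: "squarefree (a div g * (b div g))"
  proof (rule squarefree_mult_coprime)
    show "coprime (a div g) (b div g)"
      unfolding g_def using nz by (intro div_gcd_coprime) auto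
    show "squarefree (a div g)"
      by (rule squarefree_mono[of _ a]) (use ab(1) in \<open>metis dvd_triv_left\<close>, simp add: a_def)
    show "squarefree (b div g)"
      by (rule squarefree_mono[of _ b]) (use ab(2) in \<open>metis dvd_triv_left\<close>, simp add: b_def)
  qed
  have "m * n = (a * (square_part m)\<^sup>2) * (b * (square_part n)\<^sup>2)"
    unfolding a_def b_def by (simp flip: squarefree_decompose)
  also have "\<dots> = (a div g * g) * (b div g * g) * (square_part m * square_part n)\<^sup>2"
    using ab by (simp add: power_mult_distrib)
  also have "\<dots> = a div g * (b div g) * (g * square_part m * square_part n)\<^sup>2"
    by (simp add: power2_eq_square)
  finally have eq: "m * n = a div g * (b div g) * (g * square_part m * square_part n)\<^sup>2" .
  have "a div g * (b div g) \<noteq> 0" "g * square_part m * square_part n \<noteq> 0"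
    using eq assms(1,2) by auto
  then have "squarefree_part (m * n) = squarefree_part (a div g * (b div g))"
    unfolding eq by (rule squarefree_part_mult_square)
  \<comment> \<open>The number is already squarefree, so the square root in the characterisation is
    1.\<close>
  also have "\<dots> = a div g * (b div g)"
    using sqf \<open>a div g * (b div g) \<noteq> 0\<close>
    by (subst squarefree_part_int_iff) (auto intro: exI[of _ 1])
  finally show ?thesis by (simp add: g_def)
qed

context
  fixes A B :: "int set"
  assumes fin: "finite A" "finite B" and nz: "0 \<notin> A" "0 \<notin> B"
begin

text \<open>By \<open>prod_sym_diff\<close>, the product over \<open>sym_diff A B\<close> differs
  from the product of the two products only by a non-zero square.\<close>

lemma sqf_sym_diff:
  "sqf (sym_diff A B) = (sqf A div gcd (sqf A) (sqf B)) * (sqf B div gcd (sqf A) (sqf B))"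
proof -
  have "sqf (sym_diff A B) = squarefree_part (\<Prod>(sym_diff A B) * (\<Prod>(A \<inter> B))\<^sup>2)"
    unfolding sqf_def using fin nz by (subst squarefree_part_mult_square) auto
  also have "\<dots> = squarefree_part (\<Prod>A * \<Prod>B)"
    using prod_sym_diff[OF fin, of "\<lambda>x. x"] by simp
  finally show ?thesis
    unfolding sqf_def using fin nz by (subst (asm) squarefree_part_mult) auto
qed

text \<open>The form without division, from which parity, residues modulo 4 and Kronecker symbols
  are read off.\<close>

lemma sqf_sym_diff_mult_gcd:
  "sqf (sym_diff A B) * (gcd (sqf A) (sqf B))\<^sup>2 = sqf A * sqf B"
proof -
  let ?g = "gcd (sqf A) (sqf B)"
  have "sqf (sym_diff A B) * ?g\<^sup>2 = (sqf A div ?g * ?g) * (sqf B div ?g * ?g)"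
    by (simp only: sqf_sym_diff power2_eq_square ac_simps)
  then show ?thesis by simp
qed

text \<open>The product \<open>sqf A * sqf B\<close> need not divide \<open>d\<close>, but after
  division by the gcd the two factors are coprime divisors of \<open>d\<close>.\<close>

lemma sqf_sym_diff_dvd:
  assumes "sqf A dvd d" "sqf B dvd d"
  shows "sqf (sym_diff A B) dvd d"
  unfolding sqf_sym_diff
proof (rule divides_mult)
  have "sqf A \<noteq> 0" by (simp add: sqf_def)
  then show "coprime (sqf A div gcd (sqf A) (sqf B)) (sqf B div gcd (sqf A) (sqf B))"
    by (intro div_gcd_coprime) auto
  show "sqf A div gcd (sqf A) (sqf B) dvd d" "sqf B div gcd (sqf A) (sqf B) dvd d"
    using assms by (metis dvd_div_mult_self dvd_mult_left gcd_dvd1 gcd_dvd2)+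
qed

lemma odd_sqf_sym_diff:
  assumes "odd (sqf A)" "odd (sqf B)"
  shows "odd (sqf (sym_diff A B))"
  using assms sqf_sym_diff_mult_gcd by (metis even_mult_iff)

text \<open>The gcd divides the odd number \<open>sqf A\<close>, so its square is 1 modulo 4 and
  drops out of \<open>sqf_sym_diff_mult_gcd\<close>.\<close>

lemma sqf_sym_diff_cong_1:
  assumes "[sqf A = 1] (mod 4)" "[sqf B = 1] (mod 4)"
  shows "[sqf (sym_diff A B) = 1] (mod 4)"
proof -
  let ?g = "gcd (sqf A) (sqf B)"
  have "odd (sqf A)" using assms(1) by (auto simp: cong_def) presburger
  then have "odd ?g" by (meson dvd_trans gcd_dvd1)
  then obtain k where k: "?g = 2 * k + 1" by (rule oddE)
  have "?g\<^sup>2 = 1 + 4 * (k\<^sup>2 + k)"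
    unfolding k by (simp add: power2_eq_square algebra_simps)
  then have "[sqf (sym_diff A B) * ?g\<^sup>2 = sqf (sym_diff A B) * 1] (mod 4)"
    by (intro cong_mult) (simp_all only: cong_refl cong_def mod_mult_self2)
  then show ?thesis
    using cong_mult[OF assms] by (simp add: sqf_sym_diff_mult_gcd) (metis cong_sym cong_trans)
qed

text \<open>The gcd is prime to \<open>f\<close>, so its symbol is a sign and the symbol of its
  square is 1.\<close>

lemma kronecker_sqf_sym_diff:
  assumes "coprime (sqf A) (int f)" "f > 0"
  shows "kronecker (sqf (sym_diff A B)) f = kronecker (sqf A) f * kronecker (sqf B) f"
proof -
  let ?g = "gcd (sqf A) (sqf B)"
  have "coprime ?g (int f)"
    by (rule coprime_divisors[OF _ _ assms(1)]) auto
  then have "kronecker ?g f \<in> {-1, 1}"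
    using assms(2) by (rule kronecker_sign)
  then have "kronecker (?g\<^sup>2) f = 1"
    by (auto simp: power2_eq_square kronecker_mult)
  then show ?thesis
    using arg_cong[OF sqf_sym_diff_mult_gcd, of "\<lambda>n. kronecker n f"]
    by (simp add: kronecker_mult)
qed

end

section \<open>Counting\<close>

text \<open>Reduces closure of \<open>D1_sets\<close> under symmetric difference to a statement
  about parity.\<close>

lemma cong_1_or_3_mod_4_iff_odd: "[n = 1] (mod 4) \<or> [n = 3] (mod 4) \<longleftrightarrow> odd n" for n :: int
  unfolding cong_def by auto presburger+

lemma D_sets_subset: "D_sets i d S \<subseteq> D0_sets d S"
  by (auto simp: D_sets_def D1_sets_def D2_sets_def)

lemma empty_in_D_sets: "{} \<in> D_sets i d S"
  by (simp add: D_sets_def D0_sets_def D1_sets_def D2_sets_def sqf_def)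

text \<open>The subgroup property: divisibility of \<open>d\<close>, oddness and residue 1 modulo 4
  are each preserved, which covers the three families.\<close>

lemma D_sets_sym_diff:
  assumes "finite S" "0 \<notin> S" "A \<in> D_sets i d S" "B \<in> D_sets i d S"
  shows "sym_diff A B \<in> D_sets i d S"
proof -
  have "A \<subseteq> S" "B \<subseteq> S"
    using assms(3,4) D_sets_subset by (fastforce simp: D0_sets_def)+
  then have *: "finite A" "finite B" "0 \<notin> A" "0 \<notin> B" "sym_diff A B \<subseteq> S"
    using assms(1,2) by (auto intro: finite_subset)
  show ?thesis
    using assms(3,4) *(5) sqf_sym_diff_dvd[OF *(1-4)] odd_sqf_sym_diff[OF *(1-4)]
      sqf_sym_diff_cong_1[OF *(1-4)]
    by (simp add: D_sets_def D0_sets_def D1_sets_def D2_sets_def cong_1_or_3_mod_4_iff_odd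
        split: if_splits)
qed

theorem theorem2:
  fixes S :: "int set" and d i :: nat
  assumes "finite S" and "0 \<notin> S" and "d > 0" and "i \<in> {0, 1, 2}"
  shows "real (card (D_group i d S)) =
    2 ^ card S * real (totient d) / real (card (D_sets i d S))"
proof -
  let ?D = "D_sets i d S"
  \<comment> \<open>\<open>\<Theta> f\<close> is the fibre of \<open>D_group i d S\<close> over
    \<open>f\<close>; all fibres turn out to have the same size.\<close>
  define \<Theta> where "\<Theta> f = {\<theta> \<in> sign_maps S. \<forall>T\<in>?D. (\<Prod>s\<in>T. \<theta> s) * kronecker (sqf T) f = 1}" for f
  have D: "?D \<subseteq> Pow S"
    using D_sets_subset by (fastforce simp: D0_sets_def)
  have \<Theta>: "card (\<Theta> f) * card ?D = 2 ^ card S" if f: "f \<in> totatives d" for f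
    unfolding \<Theta>_def
  proof (rule card_sign_maps_extending_character[OF assms(1) D empty_in_D_sets])
    have f_pos: "f > 0" using f by (simp add: in_totatives_iff)
    \<comment> \<open>Divisibility of \<open>d\<close> by \<open>sqf T\<close>, with
      \<open>f\<close> prime to \<open>d\<close>, keeps the symbol away from 0.\<close>
    have cop: "coprime (sqf T) (int f)" if "T \<in> ?D" for T
    proof -
      have "sqf T dvd int d"
        using that D_sets_subset by (fastforce simp: D0_sets_def)
      moreover have "coprime (int d) (int f)"
        using f by (simp add: in_totatives_iff coprime_commute)
      ultimately show ?thesis by (meson coprime_divisors dvd_refl)
    qed
    fix A assume A: "A \<in> ?D"
    show "kronecker (sqf A) f \<in> {-1, 1}"
      using cop[OF A] f_pos by (rule kronecker_sign)
    fix B assume B: "B \<in> ?D"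
    show "sym_diff A B \<in> ?D"
      using assms(1,2) A B by (rule D_sets_sym_diff)
    show "kronecker (sqf (sym_diff A B)) f = kronecker (sqf A) f * kronecker (sqf B) f"
      using A B D assms(1,2) cop[OF A] f_pos
      by (intro kronecker_sqf_sym_diff) (auto intro: finite_subset)
  qed
  have "D_group i d S = (SIGMA f:totatives d. \<Theta> f)"
    by (auto simp: D_group_def \<Theta>_def)
  moreover have "finite (\<Theta> f)" for f
    unfolding \<Theta>_def sign_maps_def
    using assms(1) by (intro finite_subset[OF Collect_subset] finite_PiE) auto
  ultimately have "card (D_group i d S) * card ?D = (\<Sum>f\<in>totatives d. card (\<Theta> f) * card ?D)"
    by (simp add: card_SigmaI sum_distrib_right)
  also have "\<dots> = 2 ^ card S * totient d"
    by (simp add: \<Theta> totient_def)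
  finally have "real (card (D_group i d S)) * real (card ?D) = 2 ^ card S * real (totient d)"
    by (simp flip: of_nat_mult) (metis of_nat_mult of_nat_numeral of_nat_power)
  \<comment> \<open>Membership of \<open>{}\<close> makes the denominator non-zero, so the final
    quotient is not the default value of division by 0.\<close>
  moreover have "card ?D > 0"
    using empty_in_D_sets finite_subset[OF D] assms(1) by (auto simp: card_gt_0_iff)
  ultimately show ?thesis by (simp add: field_simps)
qed

end
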